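(* Let $\alpha_0=1$, $\beta_0=0$, and $\alpha_n=0$, $\beta_n=1$ for all $n\ge1$. Let $\psi$ be an arbitrary state on $M_2(\mathbb C)$, with parameters $0\le\lambda\le1$ and $\zeta\in\mathbb C$, $|\zeta|\le1$, and let $T_\psi$ be the associated transition operator on $\mathcal B(\mathcal H)$, $\mathcal H=\ell^2(\mathbb N)$. Then $T_\psi$ is weakly mixing (and hence ergodic) if and only if $\lambda\le\frac12$. For $\lambda>\frac12$ the fixed point space of $T_\psi$ is infinite dimensional.
   Context: $\mathbb N$ includes $0$. $\mathcal H=\ell^2(\mathbb N)$ has canonical orthonormal basis $(e_n)_{n\in\mathbb N}$; $\mathbf 1$ is the identity operator. Let $a,b\in\mathcal B(\mathcal H)$ be the diagonal operators $a e_n=\alpha_n e_n$, $b e_n=\beta_n e_n$, and let $s$ be the isometric shift $s e_n=e_{n+1}$. Writing operators on $\mathcal H\otimes\mathbb C^2$ as $2\times2$ matrices with entries in $\mathcal B(\mathcal H)$ (so $x\otimes y=(y_{i,j}x)_{i,j}$), define the unitary $$u=\begin{pmatrix} s^*as & i s^*b\\ i bs & a\end{pmatrix}.$$ For a state $\psi$ on $M_2=M_2(\mathbb C)$ let $P_\psi:\mathcal B(\mathcal H\otimes\mathbb C^2)\to\mathcal B(\mathcal H)$ be the linear extension of $P_\psi(x\otimes y)=\psi(y)x$. The transition operator associated with $\psi$ is $T_\psi(x)=P_\psi\bigl(u^*(x\otimes\mathbf 1)u\bigr)$, $x\in\mathcal B(\mathcal H)$. Every state $\psi$ on $M_2$ is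 of the form $\psi(y)=\mathrm{Tr}(\rho y)$ with $$\rho=\begin{pmatrix}\lambda & \bar\zeta\sqrt{\lambda(1-\lambda)}\\ \zeta\sqrt{\lambda(1-\lambda)} & 1-\lambda\end{pmatrix},\qquad 0\le\lambda\le1,\ |\zeta|\le1,$$ with the convention $\zeta:=0$ if $\lambda\in\{0,1\}$; these $\lambda,\zeta$ are the parameters of $\psi$. The fixed point space of $T$ is $\{x\in\mathcal B(\mathcal H):T(x)=x\}$. $T$ is ergodic if this space is $\mathbb C\mathbf 1$; $T$ is weakly mixing if $T(x)=\mu x$ with $\mu\in\mathbb C$, $|\mu|=1$, implies $x\in\mathbb C\mathbf 1$. *)

theory Defs
  imports "HOL-Analysis.Analysis"
begin

section \<open>Complex vector spaces\<close>

class scaleC =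
  fixes scaleC :: "complex \<Rightarrow> 'a \<Rightarrow> 'a"  (infixr \<open>*\<^sub>C\<close> 75)

class complex_vector = real_vector + scaleC +
  assumes scaleC_add_right: "a *\<^sub>C (x + y) = a *\<^sub>C x + a *\<^sub>C y"
    and scaleC_add_left: "(a + b) *\<^sub>C x = a *\<^sub>C x + b *\<^sub>C x"
    and scaleC_scaleC: "a *\<^sub>C b *\<^sub>C x = (a * b) *\<^sub>C x"
    and scaleC_one: "1 *\<^sub>C x = x"
    and scaleR_scaleC: "r *\<^sub>R x = complex_of_real r *\<^sub>C x"

global_interpretation complex_vector: vector_space "scaleC :: complex \<Rightarrow> 'a \<Rightarrow> 'a::complex_vector"
  by standard (simp_all add: scaleC_add_right scaleC_add_left scaleC_scaleC scaleC_one)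

definition infinite_dimensional :: "'a::complex_vector set \<Rightarrow> bool" where
  "infinite_dimensional V \<longleftrightarrow> \<not> (\<exists>B. finite B \<and> V \<subseteq> complex_vector.span B)"


section \<open>The Hilbert space $\ell^2(\mathbb{N})$\<close>

definition square_summable :: "(nat \<Rightarrow> complex) \<Rightarrow> bool" where
  "square_summable f \<longleftrightarrow> summable (\<lambda>n. (cmod (f n))\<^sup>2)"

lemma square_summable_zero: "square_summable (\<lambda>n. 0)"
  by (simp add: square_summable_def)

lemma square_summable_scale: "square_summable f \<Longrightarrow> square_summable (\<lambda>n. c * f n)"
  by (simp add: square_summable_def norm_mult power_mult_distrib summable_mult)

lemma square_summable_add:
  assumes "square_summable f" "square_summable g"
  shows "square_summable (\<lambda>n. f n + g n)"
  unfolding square_summable_def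
proof (rule summable_comparison_test')
  show "summable (\<lambda>n. 2 * ((cmod (f n))\<^sup>2 + (cmod (g n))\<^sup>2))"
    using assms unfolding square_summable_def by (intro summable_mult summable_add)
  fix n :: nat
  have "(cmod (f n + g n))\<^sup>2 \<le> (cmod (f n) + cmod (g n))\<^sup>2"
    by (intro power_mono norm_triangle_ineq) simp
  also have "\<dots> \<le> 2 * ((cmod (f n))\<^sup>2 + (cmod (g n))\<^sup>2)"
    using sum_squares_bound[of "cmod (f n)" "cmod (g n)"] by (simp add: power2_sum)
  finally show "norm ((cmod (f n + g n))\<^sup>2) \<le> 2 * ((cmod (f n))\<^sup>2 + (cmod (g n))\<^sup>2)"
    by simp
qed

lemma square_summable_uminus: "square_summable f \<Longrightarrow> square_summable (\<lambda>n. - f n)"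
  by (simp add: square_summable_def)

lemma square_summable_diff:
  "square_summable f \<Longrightarrow> square_summable g \<Longrightarrow> square_summable (\<lambda>n. f n - g n)"
  using square_summable_add[of f "\<lambda>n. - g n"] square_summable_uminus[of g] by simp

lemma square_summable_finite:
  "finite A \<Longrightarrow> (\<And>n. n \<notin> A \<Longrightarrow> f n = 0) \<Longrightarrow> square_summable f"
  unfolding square_summable_def by (rule summable_finite) auto

typedef ell2 = "{f :: nat \<Rightarrow> complex. square_summable f}" morphisms coord Abs_ell2
  using square_summable_zero by blast

setup_lifting type_definition_ell2

lemma ell2_eqI: "(\<And>n. coord x n = coord y n) \<Longrightarrow> x = y"
  by (metis coord_inject ext)

lemma coord_square_summable: "square_summable (coord x)"
  using coord by blast

lemma summable_cinner: "summable (\<lambda>n. cnj (coord x n) * coord y n)"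
proof (rule summable_norm_cancel, rule summable_comparison_test')
  show "summable (\<lambda>n. (cmod (coord x n))\<^sup>2 + (cmod (coord y n))\<^sup>2)"
    using coord_square_summable unfolding square_summable_def by (intro summable_add)
  fix n :: nat
  have "2 * (cmod (coord x n) * cmod (coord y n)) \<le> (cmod (coord x n))\<^sup>2 + (cmod (coord y n))\<^sup>2"
    using sum_squares_bound[of "cmod (coord x n)" "cmod (coord y n)"] by simp
  moreover have "0 \<le> cmod (coord x n) * cmod (coord y n)" by simp
  ultimately show "norm (norm (cnj (coord x n) * coord y n)) \<le> (cmod (coord x n))\<^sup>2 + (cmod (coord y n))\<^sup>2"
    unfolding norm_mult complex_mod_cnj real_norm_def abs_mult abs_norm_cancel by linarith
qed

definition cinner :: "ell2 \<Rightarrow> ell2 \<Rightarrow> complex" where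
  "cinner x y = (\<Sum>n. cnj (coord x n) * coord y n)"

instantiation ell2 :: complex_vector
begin

lift_definition zero_ell2 :: ell2 is "\<lambda>n. 0" by (rule square_summable_zero)
lift_definition plus_ell2 :: "ell2 \<Rightarrow> ell2 \<Rightarrow> ell2" is "\<lambda>f g n. f n + g n"
  by (rule square_summable_add)
lift_definition minus_ell2 :: "ell2 \<Rightarrow> ell2 \<Rightarrow> ell2" is "\<lambda>f g n. f n - g n"
  by (rule square_summable_diff)
lift_definition uminus_ell2 :: "ell2 \<Rightarrow> ell2" is "\<lambda>f n. - f n"
  by (rule square_summable_uminus)
lift_definition scaleC_ell2 :: "complex \<Rightarrow> ell2 \<Rightarrow> ell2" is "\<lambda>c f n. c * f n"
  by (rule square_summable_scale)
definition scaleR_ell2 :: "real \<Rightarrow> ell2 \<Rightarrow> ell2" where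
  "scaleR_ell2 r x = complex_of_real r *\<^sub>C x"

lemmas coord_simps_aux = zero_ell2.rep_eq plus_ell2.rep_eq minus_ell2.rep_eq
  uminus_ell2.rep_eq scaleC_ell2.rep_eq

instance
proof
  fix x y z :: ell2 and a b :: complex and r s :: real
  show "x + y + z = x + (y + z)" "x + y = y + x" "0 + x = x" "- x + x = 0" "x - y = x + - y"
    by (rule ell2_eqI, simp add: coord_simps_aux)+
  show "a *\<^sub>C (x + y) = a *\<^sub>C x + a *\<^sub>C y" "(a + b) *\<^sub>C x = a *\<^sub>C x + b *\<^sub>C x"
    "a *\<^sub>C b *\<^sub>C x = (a * b) *\<^sub>C x" "1 *\<^sub>C x = x"
    by (rule ell2_eqI, simp add: coord_simps_aux algebra_simps)+
  show "r *\<^sub>R x = complex_of_real r *\<^sub>C x" by (simp add: scaleR_ell2_def)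
  show "r *\<^sub>R (x + y) = r *\<^sub>R x + r *\<^sub>R y" "(r + s) *\<^sub>R x = r *\<^sub>R x + s *\<^sub>R x"
    "r *\<^sub>R s *\<^sub>R x = (r * s) *\<^sub>R x" "1 *\<^sub>R x = x"
    by (rule ell2_eqI, simp add: coord_simps_aux scaleR_ell2_def algebra_simps)+
qed

end

lemma coord_simps [simp]:
  "coord 0 n = 0" "coord (x + y) n = coord x n + coord y n" "coord (x - y) n = coord x n - coord y n"
  "coord (- x) n = - coord x n" "coord (c *\<^sub>C x) n = c * coord x n"
  "coord (r *\<^sub>R x) n = complex_of_real r * coord x n"
  by (simp_all add: coord_simps_aux scaleR_ell2_def)

instantiation ell2 :: real_inner
begin

definition inner_ell2 :: "ell2 \<Rightarrow> ell2 \<Rightarrow> real" where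
  "inner_ell2 x y = Re (cinner x y)"
definition norm_ell2 :: "ell2 \<Rightarrow> real" where
  "norm_ell2 x = sqrt (inner x x)"
definition sgn_ell2 :: "ell2 \<Rightarrow> ell2" where
  "sgn_ell2 x = x /\<^sub>R norm x"
definition dist_ell2 :: "ell2 \<Rightarrow> ell2 \<Rightarrow> real" where
  "dist_ell2 x y = norm (x - y)"
definition uniformity_ell2 :: "(ell2 \<times> ell2) filter" where
  "uniformity_ell2 = (INF e\<in>{0<..}. principal {(x, y). dist x y < e})"
definition open_ell2 :: "ell2 set \<Rightarrow> bool" where
  "open_ell2 U \<longleftrightarrow> (\<forall>x\<in>U. \<forall>\<^sub>F (x', y) in uniformity. x' = x \<longrightarrow> y \<in> U)"

lemma cinner_add_left_aux: "cinner (x + y) z = cinner x z + cinner y z"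
  unfolding cinner_def
  by (subst suminf_add[OF summable_cinner summable_cinner]) (simp add: coord_simps_aux algebra_simps)

lemma cinner_scaleC_left_aux: "cinner (c *\<^sub>C x) y = cnj c * cinner x y"
  unfolding cinner_def
  by (subst suminf_mult[OF summable_cinner, symmetric]) (simp add: coord_simps_aux algebra_simps)

lemma cinner_commute_aux: "cinner x y = cnj (cinner y x)"
proof -
  have "(\<lambda>n. cnj (cnj (coord y n) * coord x n)) sums cnj (cinner y x)"
    unfolding cinner_def by (subst sums_cnj) (rule summable_sums[OF summable_cinner])
  then have "(\<lambda>n. cnj (coord x n) * coord y n) sums cnj (cinner y x)"
    by (simp add: mult.commute)
  then show ?thesis unfolding cinner_def by (simp add: sums_iff)
qed

lemma inner_self_aux: "inner x x = (\<Sum>n. (cmod (coord x n))\<^sup>2)" for x :: ell2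
proof -
  have "cnj (coord x n) * coord x n = complex_of_real ((cmod (coord x n))\<^sup>2)" for n
    by (metis complex_norm_square mult.commute)
  then have "cinner x x = complex_of_real (\<Sum>n. (cmod (coord x n))\<^sup>2)"
    unfolding cinner_def
    using suminf_of_real[of "\<lambda>n. (cmod (coord x n))\<^sup>2", where 'a = complex]
      coord_square_summable[of x] by (simp add: square_summable_def)
  then show ?thesis by (simp add: inner_ell2_def)
qed

instance
proof
  fix x y z :: ell2 and a b :: complex and r s :: real
  show "dist x y = norm (x - y)" by (simp add: dist_ell2_def)
  show "sgn x = x /\<^sub>R norm x" by (simp add: sgn_ell2_def)
  show "uniformity = (INF e\<in>{0<..}. principal {(x, y::ell2). dist x y < e})"
    by (simp add: uniformity_ell2_def)
  show "open U \<longleftrightarrow> (\<forall>x\<in>U. \<forall>\<^sub>F (x', y) in uniformity. x' = x \<longrightarrow> y \<in> U)" for U :: "ell2 set"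
    by (simp add: open_ell2_def)
  show "inner x y = inner y x"
    unfolding inner_ell2_def by (subst cinner_commute_aux) simp
  show "inner (x + y) z = inner x z + inner y z"
    by (simp add: inner_ell2_def cinner_add_left_aux)
  show "inner (r *\<^sub>R x) y = r * inner x y"
    by (simp add: inner_ell2_def scaleR_ell2_def cinner_scaleC_left_aux)
  show "0 \<le> inner x x"
    unfolding inner_self_aux by (simp add: coord_square_summable[unfolded square_summable_def] suminf_nonneg)
  show "inner x x = 0 \<longleftrightarrow> x = 0"
  proof
    assume "inner x x = 0"
    then have "(cmod (coord x n))\<^sup>2 = 0" for n
      unfolding inner_self_aux
      by (subst (asm) suminf_eq_zero_iff) (auto simp: coord_square_summable[unfolded square_summable_def])
    then show "x = 0" by (intro ell2_eqI) (simp add: coord_simps_aux)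
  qed (simp add: inner_self_aux coord_simps_aux)
  show "norm x = sqrt (inner x x)" by (simp add: norm_ell2_def)
qed

end

lemmas cinner_add_left = cinner_add_left_aux
lemmas cinner_scaleC_left = cinner_scaleC_left_aux
lemmas cinner_commute = cinner_commute_aux

lemma cinner_add_right: "cinner z (x + y) = cinner z x + cinner z y"
  by (metis cinner_add_left cinner_commute complex_cnj_add)

lemma cinner_scaleC_right: "cinner x (c *\<^sub>C y) = c * cinner x y"
  by (metis cinner_commute cinner_scaleC_left complex_cnj_cnj complex_cnj_mult)

lemma ell2_norm_square: "(norm x)\<^sup>2 = (\<Sum>n. (cmod (coord x n))\<^sup>2)"
proof -
  have "(norm x)\<^sup>2 = inner x x" by (rule power2_norm_eq_inner)
  then show ?thesis by (simp only: inner_self_aux)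
qed

lemma norm_scaleC: "norm (c *\<^sub>C x) = cmod c * norm x" for x :: ell2
proof (rule power2_eq_imp_eq)
  show "(norm (c *\<^sub>C x))\<^sup>2 = (cmod c * norm x)\<^sup>2"
    unfolding power_mult_distrib ell2_norm_square
    by (subst suminf_mult[symmetric])
      (simp_all add: norm_mult power_mult_distrib coord_square_summable[unfolded square_summable_def])
qed simp_all

lemma cmod_cinner_le: "cmod (cinner x y) \<le> norm x * norm y"
proof (cases "cinner x y = 0")
  case False
  define c where "c = cnj (sgn (cinner x y))"
  have "c * cinner x y = cmod (cinner x y)"
    using False by (simp add: c_def sgn_div_norm complex_norm_square[symmetric] scaleR_conv_of_real
        divide_simps power2_eq_square mult.commute[of "cnj _"])
  then have "cmod (cinner x y) = inner x (c *\<^sub>C y)"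
    by (simp add: inner_ell2_def cinner_scaleC_right)
  also have "\<dots> \<le> norm x * norm (c *\<^sub>C y)" by (rule norm_cauchy_schwarz)
  also have "\<dots> = norm x * norm y" using False by (simp add: norm_scaleC c_def norm_sgn)
  finally show ?thesis .
qed simp

lift_definition basis_vec :: "nat \<Rightarrow> ell2" is "\<lambda>n k. if k = n then 1 else 0"
  by (rule_tac A = "{nat}" in square_summable_finite) auto

lemma coord_basis_vec: "coord (basis_vec n) k = (if k = n then 1 else 0)"
  by (simp add: basis_vec.rep_eq)

lemma cinner_basis_vec_left: "cinner (basis_vec n) x = coord x n"
  unfolding cinner_def coord_basis_vec
  by (subst suminf_finite[of "{n}"]) auto


section \<open>Bounded operators on $\ell^2(\mathbb{N})$\<close>

definition bounded_clinear :: "(ell2 \<Rightarrow> ell2) \<Rightarrow> bool" where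
  "bounded_clinear f \<longleftrightarrow> bounded_linear f \<and> (\<forall>c v. f (c *\<^sub>C v) = c *\<^sub>C f v)"

lemma bounded_clinearI:
  assumes "\<And>v w. f (v + w) = f v + f w" "\<And>c v. f (c *\<^sub>C v) = c *\<^sub>C f v"
    "\<And>v. norm (f v) \<le> norm v * K"
  shows "bounded_clinear f"
  unfolding bounded_clinear_def
  using assms by (auto intro!: bounded_linear_intro[of f K] simp: scaleR_scaleC)

lemma bounded_clinear_zero: "bounded_clinear (\<lambda>v. 0)"
  by (simp add: bounded_clinear_def)

typedef bop = "{f :: ell2 \<Rightarrow> ell2. bounded_clinear f}" morphisms op_apply Abs_bop
  using bounded_clinear_zero by blast

setup_lifting type_definition_bop

lemma op_apply_bounded_clinear: "bounded_clinear (op_apply x)"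
  using op_apply by blast

lemma bop_eqI: "(\<And>v. op_apply x v = op_apply y v) \<Longrightarrow> x = y"
  by (metis op_apply_inject ext)

text \<open>The multiplication of the ring of operators is composition.\<close>

instantiation bop :: "{complex_vector, ring_1}"
begin

lift_definition zero_bop :: bop is "\<lambda>v. 0" by (rule bounded_clinear_zero)
lift_definition one_bop :: bop is "\<lambda>v. v" by (simp add: bounded_clinear_def)
lift_definition plus_bop :: "bop \<Rightarrow> bop \<Rightarrow> bop" is "\<lambda>f g v. f v + g v"
  by (simp add: bounded_clinear_def bounded_linear_add scaleC_add_right)
lift_definition minus_bop :: "bop \<Rightarrow> bop \<Rightarrow> bop" is "\<lambda>f g v. f v - g v"
  by (simp add: bounded_clinear_def bounded_linear_sub complex_vector.scale_right_diff_distrib)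
lift_definition uminus_bop :: "bop \<Rightarrow> bop" is "\<lambda>f v. - f v"
  by (simp add: bounded_clinear_def bounded_linear_minus)
lift_definition times_bop :: "bop \<Rightarrow> bop \<Rightarrow> bop" is "\<lambda>f g v. f (g v)"
  by (simp add: bounded_clinear_def bounded_linear_compose)
lift_definition scaleC_bop :: "complex \<Rightarrow> bop \<Rightarrow> bop" is "\<lambda>c f v. c *\<^sub>C f v"
proof -
  fix c and f :: "ell2 \<Rightarrow> ell2"
  assume f: "bounded_clinear f"
  then obtain K where K: "\<And>v. norm (f v) \<le> norm v * K"
    unfolding bounded_clinear_def using bounded_linear.bounded by blast
  show "bounded_clinear (\<lambda>v. c *\<^sub>C f v)"
  proof (rule bounded_clinearI)
    show "norm (c *\<^sub>C f v) \<le> norm v * (cmod c * K)" for v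
      using mult_left_mono[OF K[of v], of "cmod c"] by (simp add: norm_scaleC mult.left_commute)
  qed (use f in \<open>auto simp: bounded_clinear_def bounded_linear.linear linear_add scaleC_add_right
        scaleC_scaleC mult.commute\<close>)
qed
definition scaleR_bop :: "real \<Rightarrow> bop \<Rightarrow> bop" where
  "scaleR_bop r x = complex_of_real r *\<^sub>C x"

instance
proof
  have add: "op_apply x (v + w) = op_apply x v + op_apply x w" for x v w
    using op_apply_bounded_clinear[of x] unfolding bounded_clinear_def
    by (simp add: bounded_linear.linear linear_add)
  note rep = zero_bop.rep_eq one_bop.rep_eq plus_bop.rep_eq minus_bop.rep_eq uminus_bop.rep_eq
    times_bop.rep_eq scaleC_bop.rep_eq scaleR_bop_def add
  fix x y z :: bop and a b :: complex and r s :: real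
  show "x + y + z = x + (y + z)" "x + y = y + x" "0 + x = x" "- x + x = 0" "x - y = x + - y"
    "x * y * z = x * (y * z)" "1 * x = x" "x * 1 = x"
    "(x + y) * z = x * z + y * z" "x * (y + z) = x * y + x * z"
    "a *\<^sub>C (x + y) = a *\<^sub>C x + a *\<^sub>C y" "(a + b) *\<^sub>C x = a *\<^sub>C x + b *\<^sub>C x"
    "a *\<^sub>C b *\<^sub>C x = (a * b) *\<^sub>C x" "1 *\<^sub>C x = x" "r *\<^sub>R x = complex_of_real r *\<^sub>C x"
    "r *\<^sub>R (x + y) = r *\<^sub>R x + r *\<^sub>R y" "(r + s) *\<^sub>R x = r *\<^sub>R x + s *\<^sub>R x"
    "r *\<^sub>R s *\<^sub>R x = (r * s) *\<^sub>R x" "1 *\<^sub>R x = x"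
    by (rule bop_eqI, simp add: rep scaleC_add_right scaleC_add_left scaleC_scaleC scaleC_one)+
  have "op_apply (0::bop) (basis_vec 0) \<noteq> op_apply 1 (basis_vec 0)"
    using coord_basis_vec[of 0 0] by (auto simp: rep)
  then show "(0::bop) \<noteq> 1" by metis
qed

end

lemma op_apply_simps [simp]:
  "op_apply 0 v = 0" "op_apply 1 v = v" "op_apply (x + y) v = op_apply x v + op_apply y v"
  "op_apply (x - y) v = op_apply x v - op_apply y v" "op_apply (- x) v = - op_apply x v"
  "op_apply (x * y) v = op_apply x (op_apply y v)" "op_apply (c *\<^sub>C x) v = c *\<^sub>C op_apply x v"
  by (simp_all add: zero_bop.rep_eq one_bop.rep_eq plus_bop.rep_eq minus_bop.rep_eq uminus_bop.rep_eq
    times_bop.rep_eq scaleC_bop.rep_eq)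

lemma op_apply_add: "op_apply x (v + w) = op_apply x v + op_apply x w"
  and op_apply_scaleC: "op_apply x (c *\<^sub>C v) = c *\<^sub>C op_apply x v"
  and op_apply_zero: "op_apply x 0 = 0"
  and op_apply_bounded: "\<exists>K\<ge>0. \<forall>v. norm (op_apply x v) \<le> norm v * K"
  using op_apply_bounded_clinear[of x] unfolding bounded_clinear_def
  by (simp_all add: bounded_linear.linear linear_add linear_0 bounded_linear.nonneg_bounded)

text \<open>The adjoint always exists (\<open>op_adjoint\<close>), so the definite description is never vacuous.
  The inner product \<open>cinner\<close> is conjugate-linear in its first argument.\<close>

definition adj :: "bop \<Rightarrow> bop" where
  "adj x = (THE y. \<forall>v w. cinner (op_apply y v) w = cinner v (op_apply x w))"

lemma adj_unique:
  assumes "\<And>v w. cinner (op_apply y v) w = cinner v (op_apply x w)"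
  shows "adj x = y"
  unfolding adj_def
proof (rule the_equality)
  fix z assume z: "\<forall>v w. cinner (op_apply z v) w = cinner v (op_apply x w)"
  show "z = y"
  proof (intro bop_eqI ell2_eqI)
    fix v n
    show "coord (op_apply z v) n = coord (op_apply y v) n"
      using z assms by (metis cinner_basis_vec_left cinner_commute)
  qed
qed (use assms in blast)

definition ell2_trunc :: "nat \<Rightarrow> (nat \<Rightarrow> complex) \<Rightarrow> ell2" where
  "ell2_trunc N f = (\<Sum>n<N. f n *\<^sub>C basis_vec n)"

lemma coord_sum: "coord (sum f A) n = (\<Sum>i\<in>A. coord (f i) n)"
  by (induction A rule: infinite_finite_induct) auto

lemma coord_ell2_trunc: "coord (ell2_trunc N f) n = (if n < N then f n else 0)"
  by (simp add: ell2_trunc_def coord_sum coord_basis_vec if_distrib[of "(*) _"] sum.delta' cong: if_cong)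

lemma norm_ell2_trunc: "(norm (ell2_trunc N f))\<^sup>2 = (\<Sum>n<N. (cmod (f n))\<^sup>2)"
  unfolding ell2_norm_square coord_ell2_trunc
  by (subst suminf_finite[of "{..<N}"]) auto

lemma cinner_apply_ell2_trunc:
  "cinner (op_apply x (ell2_trunc N f)) v = (\<Sum>n<N. cnj (f n) * cinner (op_apply x (basis_vec n)) v)"
proof (induction N)
  case 0
  then show ?case
    by (simp add: ell2_trunc_def op_apply_zero) (simp add: cinner_def)
next
  case (Suc N)
  then show ?case
    by (simp add: ell2_trunc_def op_apply_add op_apply_scaleC cinner_add_left cinner_scaleC_left)
qed

lemma ell2_trunc_tendsto: "(\<lambda>N. ell2_trunc N (coord w)) \<longlonglongrightarrow> w"
proof -
  have sm: "summable (\<lambda>n. (cmod (coord w n))\<^sup>2)"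
    using coord_square_summable by (simp add: square_summable_def)
  have "(norm (ell2_trunc N (coord w) - w))\<^sup>2 = (\<Sum>n. (cmod (coord w (n + N)))\<^sup>2)" for N
  proof -
    have "(norm (ell2_trunc N (coord w) - w))\<^sup>2 = (\<Sum>n. if n < N then 0 else (cmod (coord w n))\<^sup>2)"
      unfolding ell2_norm_square by (intro suminf_cong) (simp add: coord_ell2_trunc)
    also have "\<dots> = (\<Sum>n. if n + N < N then 0 else (cmod (coord w (n + N)))\<^sup>2)
       + (\<Sum>n<N. if n < N then 0 else (cmod (coord w n))\<^sup>2)"
      by (rule suminf_split_initial_segment, rule summable_comparison_test'[OF sm]) auto
    finally show ?thesis by simp
  qed
  moreover have "(\<lambda>N. \<Sum>n. (cmod (coord w (n + N)))\<^sup>2) \<longlonglongrightarrow> 0"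
    by (rule suminf_exist_split2[OF sm])
  ultimately have "(\<lambda>N. sqrt ((norm (ell2_trunc N (coord w) - w))\<^sup>2)) \<longlonglongrightarrow> sqrt 0"
    by (intro tendsto_real_sqrt) simp
  then have "(\<lambda>N. norm (ell2_trunc N (coord w) - w)) \<longlonglongrightarrow> 0" by simp
  then show ?thesis using LIM_zero_iff tendsto_norm_zero_iff by blast
qed

lemma adjoint_exists: "\<exists>y. \<forall>v w. cinner (op_apply y v) w = cinner v (op_apply x w)"
proof -
  obtain K where K: "K \<ge> 0" "\<And>v. norm (op_apply x v) \<le> norm v * K"
    using op_apply_bounded by blast
  define g where "g v n = cinner (op_apply x (basis_vec n)) v" for v n
  have bd: "(\<Sum>n<N. (cmod (g v n))\<^sup>2) \<le> (K * norm v)\<^sup>2" for v N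
  proof -
    define S where "S = (\<Sum>n<N. (cmod (g v n))\<^sup>2)"
    have S0: "S \<ge> 0" by (simp add: S_def sum_nonneg)
    have "cinner (op_apply x (ell2_trunc N (g v))) v = (\<Sum>n<N. cnj (g v n) * g v n)"
      by (simp add: cinner_apply_ell2_trunc g_def)
    also have "\<dots> = complex_of_real S"
      unfolding S_def of_real_sum
      by (rule sum.cong) (simp_all only: complex_norm_square mult.commute)
    finally have "S = cmod (cinner (op_apply x (ell2_trunc N (g v))) v)"
      using S0 by simp
    also have "\<dots> \<le> norm (op_apply x (ell2_trunc N (g v))) * norm v" by (rule cmod_cinner_le)
    also have "\<dots> \<le> (norm (ell2_trunc N (g v)) * K) * norm v"
      by (intro mult_right_mono K) simp
    also have "norm (ell2_trunc N (g v)) = sqrt S"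
      by (metis S_def norm_ge_zero norm_ell2_trunc real_sqrt_unique)
    finally have *: "sqrt S * sqrt S \<le> sqrt S * (K * norm v)" using S0 by (simp add: ac_simps)
    have "sqrt S \<le> K * norm v"
    proof (cases "S = 0")
      case False
      then have "sqrt S > 0" using S0 by simp
      with * show ?thesis by (simp only: mult_le_cancel_left_pos)
    qed (use K in simp)
    then have "(sqrt S)\<^sup>2 \<le> (K * norm v)\<^sup>2" by (rule power_mono) (simp add: S0)
    then show ?thesis using S0 by (simp add: S_def)
  qed
  have sm: "summable (\<lambda>n. (cmod (g v n))\<^sup>2)" for v
    by (rule summableI_nonneg_bounded[OF _ bd]) simp
  define h where "h v = Abs_ell2 (g v)" for v
  have ch: "coord (h v) = g v" for v
    unfolding h_def by (rule Abs_ell2_inverse) (simp add: square_summable_def sm)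
  have nh: "norm (h v) \<le> norm v * K" for v
  proof -
    have "(norm (h v))\<^sup>2 \<le> (K * norm v)\<^sup>2"
      unfolding ell2_norm_square ch by (rule suminf_le_const[OF sm bd])
    then show ?thesis unfolding mult.commute[of K] by (rule power2_le_imp_le) (simp add: K(1))
  qed
  have hb: "bounded_clinear h"
    by (rule bounded_clinearI[OF _ _ nh])
      (rule ell2_eqI, simp add: ch g_def cinner_add_right cinner_scaleC_right)+
  have *: "cinner (op_apply x w) v = cinner w (h v)" for v w
  proof -
    have bl: "bounded_linear (op_apply x)"
      using op_apply_bounded_clinear bounded_clinear_def by blast
    have bc: "bounded_linear (\<lambda>w. cnj (cinner v' w))" for v'
    proof (rule bounded_linear_intro[where K = "norm v'"])
      show "norm (cnj (cinner v' w)) \<le> norm w * norm v'" for w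
        using cmod_cinner_le[of v' w] by (simp add: mult.commute)
    qed (simp_all add: cinner_add_right cinner_scaleC_right scaleR_scaleC scaleR_conv_of_real)
    have "(\<lambda>N. cnj (cinner v (op_apply x (ell2_trunc N (coord w))))) \<longlonglongrightarrow> cnj (cinner v (op_apply x w))"
      by (intro bounded_linear.tendsto[OF bc] bounded_linear.tendsto[OF bl] ell2_trunc_tendsto)
    then have "(\<lambda>N. \<Sum>n<N. cnj (coord w n) * g v n) \<longlonglongrightarrow> cinner (op_apply x w) v"
      by (simp add: cinner_commute[symmetric] cinner_apply_ell2_trunc g_def)
    moreover have "(\<lambda>N. \<Sum>n<N. cnj (coord w n) * g v n) \<longlonglongrightarrow> cinner w (h v)"
      using summable_LIMSEQ[OF summable_cinner[of w "h v"]] by (simp add: ch cinner_def)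
    ultimately show ?thesis by (rule LIMSEQ_unique)
  qed
  have "cinner (op_apply (Abs_bop h) v) w = cinner v (op_apply x w)" for v w
    using * hb by (metis Abs_bop_inverse cinner_commute mem_Collect_eq)
  then show ?thesis by blast
qed

lemma op_adjoint: "cinner (op_apply (adj x) v) w = cinner v (op_apply x w)"
  using adjoint_exists[of x] adj_unique by metis

lift_definition diag_vec :: "(nat \<Rightarrow> complex) \<Rightarrow> ell2 \<Rightarrow> ell2" is
  "\<lambda>\<alpha> f n. if bounded (range \<alpha>) then \<alpha> n * f n else 0"
proof -
  fix \<alpha> f :: "nat \<Rightarrow> complex"
  assume f: "square_summable f"
  show "square_summable (\<lambda>n. if bounded (range \<alpha>) then \<alpha> n * f n else 0)"
  proof (cases "bounded (range \<alpha>)")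
    case True
    then obtain K where K: "\<And>n. cmod (\<alpha> n) \<le> K" unfolding bounded_iff by blast
    show ?thesis unfolding square_summable_def
    proof (rule summable_comparison_test')
      show "summable (\<lambda>n. K\<^sup>2 * (cmod (f n))\<^sup>2)"
        using f unfolding square_summable_def by (rule summable_mult)
      show "norm ((cmod (if bounded (range \<alpha>) then \<alpha> n * f n else 0))\<^sup>2) \<le> K\<^sup>2 * (cmod (f n))\<^sup>2" for n
        using K[of n] True by (auto simp: norm_mult power_mult_distrib intro!: mult_right_mono power_mono)
    qed
  qed (simp add: square_summable_zero)
qed

lift_definition shift_vec :: "ell2 \<Rightarrow> ell2" is
  "\<lambda>f n. case n of 0 \<Rightarrow> 0 | Suc m \<Rightarrow> f m"
  unfolding square_summable_def by (subst summable_Suc_iff[symmetric]) simp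

text \<open>The diagonal operator \<open>e\<^sub>n \<mapsto> \<alpha>\<^sub>n e\<^sub>n\<close>; for unbounded \<open>\<alpha>\<close> there is no such
  bounded operator and the value is a dummy.\<close>

lift_definition diag_op :: "(nat \<Rightarrow> complex) \<Rightarrow> bop" is diag_vec
proof -
  fix \<alpha> :: "nat \<Rightarrow> complex"
  show "bounded_clinear (diag_vec \<alpha>)"
  proof (cases "bounded (range \<alpha>)")
    case True
    then obtain K where K: "\<And>n. cmod (\<alpha> n) \<le> K" unfolding bounded_iff by blast
    then have K0: "K \<ge> 0" using norm_ge_zero order_trans by blast
    show ?thesis
    proof (rule bounded_clinearI)
      fix v :: ell2
      have "(norm (diag_vec \<alpha> v))\<^sup>2 \<le> (norm v * K)\<^sup>2"
        unfolding ell2_norm_square power_mult_distrib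
      proof (subst suminf_mult2, goal_cases)
        case 2
        show ?case
        proof (rule suminf_le)
          show "(cmod (coord (diag_vec \<alpha> v) n))\<^sup>2 \<le> (cmod (coord v n))\<^sup>2 * K\<^sup>2" for n
            using K[of n] True
            by (auto simp: diag_vec.rep_eq norm_mult power_mult_distrib mult.commute[of _ "K\<^sup>2"]
                intro!: mult_right_mono power_mono)
          show "summable (\<lambda>n. (cmod (coord (diag_vec \<alpha> v) n))\<^sup>2)"
            using coord_square_summable by (simp add: square_summable_def)
          show "summable (\<lambda>n. (cmod (coord v n))\<^sup>2 * K\<^sup>2)"
            using coord_square_summable by (intro summable_mult2) (simp add: square_summable_def)
        qed
      qed (use coord_square_summable in \<open>simp add: square_summable_def\<close>)
      then show "norm (diag_vec \<alpha> v) \<le> norm v * K"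
        by (rule power2_le_imp_le) (simp add: K0)
    qed (rule ell2_eqI, simp add: diag_vec.rep_eq algebra_simps)+
  next
    case False
    then have "diag_vec \<alpha> = (\<lambda>v. 0)"
      by (intro ext ell2_eqI) (simp add: diag_vec.rep_eq)
    then show ?thesis by (simp add: bounded_clinear_zero)
  qed
qed

lift_definition shift_op :: bop is shift_vec
proof (rule bounded_clinearI[where K = 1])
  fix v :: ell2
  have "(norm (shift_vec v))\<^sup>2 = (norm v)\<^sup>2"
    unfolding ell2_norm_square
    using suminf_split_head[OF coord_square_summable[of "shift_vec v", unfolded square_summable_def]]
    by (simp add: shift_vec.rep_eq)
  then show "norm (shift_vec v) \<le> norm v * 1" by simp
qed (rule ell2_eqI, simp add: shift_vec.rep_eq split: nat.split)+

lemma diag_op_basis_vec: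
  "bounded (range \<alpha>) \<Longrightarrow> op_apply (diag_op \<alpha>) (basis_vec n) = \<alpha> n *\<^sub>C basis_vec n"
  by (rule ell2_eqI) (simp add: diag_op.rep_eq diag_vec.rep_eq coord_basis_vec)

lemma shift_op_basis_vec: "op_apply shift_op (basis_vec n) = basis_vec (Suc n)"
  by (rule ell2_eqI) (simp add: shift_op.rep_eq shift_vec.rep_eq coord_basis_vec split: nat.split)


section \<open>Operators on $\ell^2(\mathbb{N}) \otimes \mathbb{C}^2$ and transition operators\<close>

text \<open>An operator on $\ell^2(\mathbb{N}) \otimes \mathbb{C}^2$ is a $2\times 2$ matrix over \<^typ>\<open>bop\<close>;
  the product of two such operators is the matrix product \<open>**\<close> of the library, and the
  Hilbert space adjoint is the transposed matrix of the adjoints of the entries.\<close>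

definition op_tensor :: "bop \<Rightarrow> complex^2^2 \<Rightarrow> bop^2^2"  (infixr \<open>\<otimes>\<^sub>o\<close> 70) where
  "x \<otimes>\<^sub>o y = (\<chi> i j. (y $ i $ j) *\<^sub>C x)"

definition mat_adj :: "bop^2^2 \<Rightarrow> bop^2^2" where
  "mat_adj X = (\<chi> i j. adj (X $ j $ i))"

definition cmat_adj :: "complex^2^2 \<Rightarrow> complex^2^2" where
  "cmat_adj y = (\<chi> i j. cnj (y $ j $ i))"

definition cmat_unit :: "2 \<Rightarrow> 2 \<Rightarrow> complex^2^2" where
  "cmat_unit k l = (\<chi> i j. if i = k \<and> j = l then 1 else 0)"

definition is_state :: "(complex^2^2 \<Rightarrow> complex) \<Rightarrow> bool" where
  "is_state \<psi> \<longleftrightarrow>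
     (\<forall>y z. \<psi> (y + z) = \<psi> y + \<psi> z) \<and>
     (\<forall>c y. \<psi> (\<chi> i j. c * y $ i $ j) = c * \<psi> y) \<and>
     (\<forall>y. \<psi> (cmat_adj y ** y) \<in> \<real>\<^sub>\<ge>\<^sub>0) \<and>
     \<psi> (mat 1) = 1"

definition density_matrix :: "real \<Rightarrow> complex \<Rightarrow> complex^2^2" where
  "density_matrix lam zeta = vector
     [vector [of_real lam, cnj zeta * of_real (sqrt (lam * (1 - lam)))],
      vector [zeta * of_real (sqrt (lam * (1 - lam))), of_real (1 - lam)]]"

text \<open>Every state has such parameters (\<open>state_parameters_exist\<close> below).\<close>

definition state_parameters :: "(complex^2^2 \<Rightarrow> complex) \<Rightarrow> real \<Rightarrow> complex \<Rightarrow> bool" where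
  "state_parameters \<psi> lam zeta \<longleftrightarrow>
     0 \<le> lam \<and> lam \<le> 1 \<and> cmod zeta \<le> 1 \<and> (lam \<in> {0, 1} \<longrightarrow> zeta = 0) \<and>
     (\<forall>y. \<psi> y = trace (density_matrix lam zeta ** y))"

text \<open>The map $P_\psi$, written out in matrix units, since $X = \sum_{k,l} X_{k,l} \otimes e_{k,l}$; the lemmas
  below say that for linear \<open>\<psi>\<close> this is the linear extension of
  $x \otimes y \mapsto \psi(y) x$.\<close>

definition cond_exp :: "(complex^2^2 \<Rightarrow> complex) \<Rightarrow> bop^2^2 \<Rightarrow> bop" where
  "cond_exp \<psi> X = (\<Sum>k\<in>UNIV. \<Sum>l\<in>UNIV. \<psi> (cmat_unit k l) *\<^sub>C (X $ k $ l))"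

lemma cond_exp_add: "cond_exp \<psi> (X + Y) = cond_exp \<psi> X + cond_exp \<psi> Y"
  by (simp add: cond_exp_def scaleC_add_right sum.distrib)

lemma cond_exp_scale: "cond_exp \<psi> (\<chi> i j. c *\<^sub>C X $ i $ j) = c *\<^sub>C cond_exp \<psi> X"
  by (simp add: cond_exp_def complex_vector.scale_sum_right scaleC_scaleC mult.commute)

lemma matrix_unit_decomp: "(y :: complex^2^2) =
  (\<chi> i j. y$1$1 * cmat_unit 1 1 $i$j) + (\<chi> i j. y$1$2 * cmat_unit 1 2 $i$j) +
  (\<chi> i j. y$2$1 * cmat_unit 2 1 $i$j) + (\<chi> i j. y$2$2 * cmat_unit 2 2 $i$j)"
  by (simp add: vec_eq_iff forall_2 cmat_unit_def)

lemma is_state_expand: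
  assumes "is_state \<psi>"
  shows "\<psi> y = y$1$1 * \<psi> (cmat_unit 1 1) + y$1$2 * \<psi> (cmat_unit 1 2) +
    y$2$1 * \<psi> (cmat_unit 2 1) + y$2$2 * \<psi> (cmat_unit 2 2)"
  using assms unfolding is_state_def by (subst matrix_unit_decomp) simp

lemma cond_exp_tensor:
  assumes "is_state \<psi>"
  shows "cond_exp \<psi> (x \<otimes>\<^sub>o y) = \<psi> y *\<^sub>C x"
  unfolding is_state_expand[OF assms, of y] cond_exp_def
  by (simp add: UNIV_2 op_tensor_def scaleC_scaleC scaleC_add_left mult.commute add.assoc)

lemma trace_density_matrix:
  "trace (density_matrix lam zeta ** y) =
    of_real lam * y$1$1 + zeta * of_real (sqrt (lam * (1 - lam))) * y$1$2 +
    cnj zeta * of_real (sqrt (lam * (1 - lam))) * y$2$1 + of_real (1 - lam) * y$2$2"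
  by (simp add: trace_def matrix_matrix_mult_def density_matrix_def sum_2)

lemma state_parameters_exist:
  assumes "is_state \<psi>"
  shows "\<exists>lam zeta. state_parameters \<psi> lam zeta"
proof -
  define p where "p k l = \<psi> (cmat_unit k l)" for k l
  have ex: "\<psi> y = y$1$1 * p 1 1 + y$1$2 * p 1 2 + y$2$1 * p 2 1 + y$2$2 * p 2 2" for y
    unfolding p_def by (rule is_state_expand[OF assms])
  have pos: "cnj v * v * p 1 1 + cnj v * w * p 1 2 + cnj w * v * p 2 1 + cnj w * w * p 2 2
      \<in> \<real>\<^sub>\<ge>\<^sub>0" for v w
  proof -
    define y :: "complex^2^2" where "y = vector [vector [v, w], vector [0, 0]]"
    have "\<psi> (cmat_adj y ** y) \<in> \<real>\<^sub>\<ge>\<^sub>0" using assms by (simp add: is_state_def)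
    then show ?thesis
      by (simp add: ex matrix_matrix_mult_def sum_2 cmat_adj_def y_def)
  qed
  have one: "p 1 1 + p 2 2 = 1"
    using assms ex[of "mat 1"] by (simp add: is_state_def mat_def)
  obtain lam where lam: "p 1 1 = of_real lam" "lam \<ge> 0"
    using pos[of 1 0] by (auto simp: nonneg_Reals_def)
  obtain lam' where lam': "p 2 2 = of_real lam'" "lam' \<ge> 0"
    using pos[of 0 1] by (auto simp: nonneg_Reals_def)
  have lam'_eq: "lam' = 1 - lam"
    using one lam lam' by (metis add_diff_cancel_left' of_real_1 of_real_add of_real_eq_iff)
  have "Im (p 1 2 + p 2 1) = 0" "Re (p 1 2 - p 2 1) = 0"
    using pos[of 1 1] pos[of 1 \<i>] lam lam' by (auto simp: complex_nonneg_Reals_iff)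
  then have p21: "p 2 1 = cnj (p 1 2)" by (simp add: complex_eq_iff)
  define m where "m = (cmod (p 1 2))\<^sup>2"
  have m: "p 1 2 * cnj (p 1 2) = of_real m" "m \<ge> 0"
    by (simp_all add: m_def complex_norm_square[symmetric])
  have quad: "0 \<le> r\<^sup>2 * lam - 2 * r * m + m * lam'" for r
  proof -
    have "of_real (r\<^sup>2 * lam - 2 * r * m + m * lam') \<in> (\<real>\<^sub>\<ge>\<^sub>0 :: complex set)"
      using pos[of "of_real r" "- cnj (p 1 2)"] m(1)
      by (simp add: lam lam' p21 algebra_simps power2_eq_square)
    then show ?thesis by (simp del: of_real_add of_real_diff of_real_mult of_real_power)
  qed
  have bound: "m \<le> lam * lam'"
  proof (cases "lam' = 0")
    case True
    then have "m\<^sup>2 \<le> 0" using quad[of m] lam'_eq by (simp add: power2_eq_square)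
    then show ?thesis using True by simp
  next
    case False
    have "0 \<le> lam' * (lam * lam' - m)"
      using quad[of lam'] by (simp add: algebra_simps power2_eq_square)
    then show ?thesis using False lam'(2) by (simp add: zero_le_mult_iff)
  qed
  define q where "q = sqrt (lam * (1 - lam))"
  have q: "cmod (p 1 2) \<le> q"
    using bound unfolding q_def m_def lam'_eq by (rule real_le_rsqrt)
  define zeta where "zeta = p 1 2 / of_real q"
  have zq: "zeta * of_real q = p 1 2"
    using q by (cases "q = 0") (auto simp: zeta_def)
  have "cmod zeta \<le> 1"
    using q norm_ge_zero[of "p 1 2"] by (auto simp: zeta_def norm_divide divide_le_eq)
  moreover have "lam \<in> {0, 1} \<longrightarrow> zeta = 0" by (auto simp: zeta_def q_def)
  moreover have "\<psi> y = trace (density_matrix lam zeta ** y)" for y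
  proof -
    have "cnj zeta * of_real q = p 2 1" by (simp add: p21 flip: zq)
    then show ?thesis
      using zq lam(1) lam'(1)
      unfolding trace_density_matrix q_def[symmetric] lam'_eq ex[of y] by (simp add: mult.commute)
  qed
  ultimately have "state_parameters \<psi> lam zeta"
    using lam(2) lam'(2) lam'_eq by (simp add: state_parameters_def)
  then show ?thesis by blast
qed

definition coupling_op :: "(nat \<Rightarrow> complex) \<Rightarrow> (nat \<Rightarrow> complex) \<Rightarrow> bop^2^2" where
  "coupling_op \<alpha> \<beta> =
    (let a = diag_op \<alpha>; b = diag_op \<beta>; s = shift_op
     in vector [vector [adj s * a * s, \<i> *\<^sub>C (adj s * b)],
                vector [\<i> *\<^sub>C (b * s), a]])"

definition transition_op ::
    "(nat \<Rightarrow> complex) \<Rightarrow> (nat \<Rightarrow> complex) \<Rightarrow> (complex^2^2 \<Rightarrow> complex) \<Rightarrow> bop \<Rightarrow> bop" where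
  "transition_op \<alpha> \<beta> \<psi> x =
     cond_exp \<psi> (mat_adj (coupling_op \<alpha> \<beta>) ** (x \<otimes>\<^sub>o mat 1) ** coupling_op \<alpha> \<beta>)"

definition scalar_ops :: "bop set" where
  "scalar_ops = range (\<lambda>c. c *\<^sub>C 1)"

definition fixed_points :: "(bop \<Rightarrow> bop) \<Rightarrow> bop set" where
  "fixed_points T = {x. T x = x}"

definition ergodic :: "(bop \<Rightarrow> bop) \<Rightarrow> bool" where
  "ergodic T \<longleftrightarrow> fixed_points T = scalar_ops"

definition weakly_mixing :: "(bop \<Rightarrow> bop) \<Rightarrow> bool" where
  "weakly_mixing T \<longleftrightarrow> (\<forall>\<mu> x. cmod \<mu> = 1 \<longrightarrow> T x = \<mu> *\<^sub>C x \<longrightarrow> x \<in> scalar_ops)"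

end

theory Submission
  imports Defs
begin

text \<open>
  Let \<open>S\<close> be the shift, \<open>p\<close> the projection onto the first basis vector, and
  \<open>\<kappa> = \<i> \<zeta> sqrt (\<lambda> (1 - \<lambda>))\<close>. For the given weights the coupling matrix consists of
  \<open>0\<close>, \<open>\<i> adj S\<close>, \<open>\<i> S\<close> and \<open>p\<close>, and multiplying out gives
  \<open>T x = \<lambda> adj S x S + (1 - \<lambda>) (S x adj S + p x p) - \<kappa> adj S x p - cnj \<kappa> p x S\<close>
  (\<open>transition_op_eq_walk_op\<close>). On the matrix entries of \<open>x\<close> this is a random walk along each
  diagonal, with probability \<open>\<lambda>\<close> of moving away from the boundary of the index quadrant and
  \<open>1 - \<lambda>\<close> of moving towards it. The parameter \<open>\<zeta>\<close> enters only through the boundary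
  entries, where a diagonal sees the boundary entry of the next diagonal further out. The main
  diagonal reflects the walk, the other diagonals lose mass at the boundary.

  If \<open>\<lambda> > 1/2\<close>, the walk drifts to infinity, and the recurrence has two bounded solutions on each
  diagonal, \<open>1\<close> and \<open>r\<^sup>n\<close> with \<open>r = (1 - \<lambda>) / \<lambda> < 1\<close>. One free parameter per diagonal survives
  the boundary equations; explicit fixed points supported on two adjacent diagonals are
  \<open>fixed_op\<close>, and they are linearly independent.

  If \<open>\<lambda> \<le> 1/2\<close> and \<open>T x = \<mu> x\<close> with \<open>\<mu>\<close> on the unit circle, the moduli of the entries along a
  diagonal form a bounded subharmonic sequence for a walk without outward drift, hence are largest at the
  boundary (\<open>bounded_subharmonic_le_initial\<close>). Off the main diagonal the boundary equation, together with
  \<open>\<bar>\<kappa>\<bar> \<le> 1 - \<lambda>\<close>, shows that the boundary moduli do not decrease from one diagonal to the next one further out.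
  They form the first column (or row) of a bounded operator and so tend to \<open>0\<close>; therefore they all
  vanish (\<open>subharmonic_triangle_vanishes\<close>). What remains is the main diagonal, where the
  reflecting walk admits only constants, with \<open>\<mu> = 1\<close>. This argument includes \<open>\<lambda> = 1/2\<close>,
  \<open>\<bar>\<zeta>\<bar> = 1\<close>, where nothing is lost between neighbouring diagonals and only square summability
  excludes further eigenvectors.
\<close>


section \<open>Matrix entries and adjoints\<close>

definition entry :: "bop \<Rightarrow> nat \<Rightarrow> nat \<Rightarrow> complex" where
  "entry x m n = coord (op_apply x (basis_vec n)) m"

lemma entry_linear [simp]:
  "entry (x + y) m n = entry x m n + entry y m n"
  "entry (x - y) m n = entry x m n - entry y m n"
  "entry (c *\<^sub>C x) m n = c * entry x m n"
  by (simp_all add: entry_def)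

lemma entry_one: "entry 1 m n = (if m = n then 1 else 0)"
  by (simp add: entry_def coord_basis_vec)

lemma entry_adj: "entry (adj x) m n = cnj (entry x n m)"
  unfolding entry_def cinner_basis_vec_left[symmetric]
  by (metis cinner_commute op_adjoint)

text \<open>Row \<open>m\<close> of \<open>x\<close> is the conjugate of the vector \<open>adj x e\<^sub>m\<close>, so each coordinate of
  \<open>x v\<close> is the inner product of \<open>v\<close> with a vector made of entries of \<open>x\<close>.\<close>

lemma bop_eq_entryI:
  assumes "\<And>m n. entry x m n = entry y m n"
  shows "x = y"
proof (intro bop_eqI ell2_eqI)
  fix v m
  have "op_apply (adj x) (basis_vec m) = op_apply (adj y) (basis_vec m)"
    by (rule ell2_eqI) (metis assms entry_adj entry_def)
  then show "coord (op_apply x v) m = coord (op_apply y v) m"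
    by (metis cinner_basis_vec_left op_adjoint)
qed

lemma entry_bounded: "\<exists>K. \<forall>m n. cmod (entry x m n) \<le> K"
proof -
  obtain K where K: "\<And>v. norm (op_apply x v) \<le> norm v * K"
    using op_apply_bounded by blast
  have n1: "norm (basis_vec n) = 1" for n
  proof -
    have "(norm (basis_vec n))\<^sup>2 = (1::real)"
      unfolding ell2_norm_square coord_basis_vec by (subst suminf_finite[of "{n}"]) auto
    then show ?thesis by (simp add: power2_eq_1_iff) (smt (verit) norm_ge_zero)
  qed
  have "cmod (entry x m n) \<le> K" for m n
    using cmod_cinner_le[of "basis_vec m" "op_apply x (basis_vec n)"] K[of "basis_vec n"]
    by (simp add: entry_def n1 cinner_basis_vec_left)
  then show ?thesis by blast
qed

lemma entry_column_tendsto_zero: "(\<lambda>m. entry x m n) \<longlonglongrightarrow> 0"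
proof -
  have "(\<lambda>m. (cmod (entry x m n))\<^sup>2) \<longlonglongrightarrow> 0"
    using coord_square_summable[of "op_apply x (basis_vec n)"]
    unfolding square_summable_def entry_def by (rule summable_LIMSEQ_zero)
  then have "(\<lambda>m. sqrt ((cmod (entry x m n))\<^sup>2)) \<longlonglongrightarrow> sqrt 0"
    by (rule tendsto_real_sqrt)
  then show ?thesis by (simp add: tendsto_norm_zero_iff)
qed

lemma entry_row_tendsto_zero: "(\<lambda>n. entry x m n) \<longlonglongrightarrow> 0"
proof -
  have "(\<lambda>n. cnj (entry (adj x) n m)) \<longlonglongrightarrow> cnj 0"
    by (intro tendsto_cnj entry_column_tendsto_zero)
  then show ?thesis by (simp add: entry_adj)
qed

lemma adj_adj: "adj (adj x) = x"
  by (rule bop_eq_entryI) (simp add: entry_adj)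

lemma adj_scaleC: "adj (c *\<^sub>C x) = cnj c *\<^sub>C adj x"
  by (rule bop_eq_entryI) (simp add: entry_adj)

lemma adj_zero: "adj 0 = 0"
  by (rule adj_unique) (simp add: cinner_def)

lemma entry_diag_op:
  "bounded (range \<alpha>) \<Longrightarrow> entry (diag_op \<alpha>) m n = (if m = n then \<alpha> n else 0)"
  by (simp add: entry_def diag_op_basis_vec coord_basis_vec)

lemma coord_diag_op:
  "bounded (range \<alpha>) \<Longrightarrow> coord (op_apply (diag_op \<alpha>) v) n = \<alpha> n * coord v n"
  by (simp add: diag_op.rep_eq diag_vec.rep_eq)

lemma coord_shift_op:
  "coord (op_apply shift_op v) n = (case n of 0 \<Rightarrow> 0 | Suc m \<Rightarrow> coord v m)"
  by (simp add: shift_op.rep_eq shift_vec.rep_eq)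

lemma coord_adj_shift_op: "coord (op_apply (adj shift_op) v) n = coord v (Suc n)"
  by (metis cinner_basis_vec_left cinner_commute op_adjoint shift_op_basis_vec)

lemma adj_shift_op_basis_vec:
  "op_apply (adj shift_op) (basis_vec n) = (case n of 0 \<Rightarrow> 0 | Suc m \<Rightarrow> basis_vec m)"
  by (rule ell2_eqI) (auto simp: coord_adj_shift_op coord_basis_vec split: nat.split)


section \<open>The transition operator as a walk along the diagonals\<close>

definition vacuum_proj :: bop where
  "vacuum_proj = diag_op (\<lambda>n. if n = 0 then 1 else 0)"

lemma bounded_range_If: "bounded (range (\<lambda>n. if P n then c else d))"
  for c d :: complex
  by (rule finite_imp_bounded, rule finite_subset[of _ "{c, d}"]) auto

lemma coord_vacuum_proj: "coord (op_apply vacuum_proj v) n = (if n = 0 then coord v 0 else 0)"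
  by (simp add: vacuum_proj_def coord_diag_op[OF bounded_range_If])

lemma vacuum_proj_basis_vec:
  "op_apply vacuum_proj (basis_vec n) = (if n = 0 then basis_vec 0 else 0)"
  by (rule ell2_eqI) (simp add: coord_vacuum_proj coord_basis_vec)

lemma adj_vacuum_proj: "adj vacuum_proj = vacuum_proj"
  by (rule bop_eq_entryI) (simp add: entry_adj vacuum_proj_def entry_diag_op[OF bounded_range_If])

text \<open>The transition operator in expanded form. All dependence on the off-diagonal part of the
  density matrix is carried by the single coefficient \<open>\<kappa>\<close>.\<close>

definition walk_op :: "real \<Rightarrow> complex \<Rightarrow> bop \<Rightarrow> bop" where
  "walk_op lam \<kappa> x =
     of_real lam *\<^sub>C (adj shift_op * x * shift_op)
     + of_real (1 - lam) *\<^sub>C (shift_op * x * adj shift_op + vacuum_proj * x * vacuum_proj)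
     - \<kappa> *\<^sub>C (adj shift_op * x * vacuum_proj) - cnj \<kappa> *\<^sub>C (vacuum_proj * x * shift_op)"

text \<open>The compression \<open>adj S * p * S\<close> vanishes and the operator \<open>b\<close> is the projection onto
  the range of \<open>S\<close>, so the coupling matrix collapses to shifts and \<open>p\<close>.\<close>

lemma transition_op_eq_walk_op:
  assumes "\<alpha> 0 = 1" and "\<beta> 0 = 0"
    and "\<And>n. n \<ge> 1 \<Longrightarrow> \<alpha> n = 0" and "\<And>n. n \<ge> 1 \<Longrightarrow> \<beta> n = 1"
    and "state_parameters \<psi> lam zeta"
  shows "transition_op \<alpha> \<beta> \<psi> = walk_op lam (\<i> * zeta * of_real (sqrt (lam * (1 - lam))))"
proof
  fix x
  have \<alpha>: "\<alpha> = (\<lambda>n. if n = 0 then 1 else 0)" and \<beta>: "\<beta> = (\<lambda>n. if n = 0 then 0 else 1)"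
    using assms by (auto simp: fun_eq_iff)
  have a: "diag_op \<alpha> = vacuum_proj"
    by (simp add: \<alpha> vacuum_proj_def)
  have 1: "adj shift_op * vacuum_proj * shift_op = 0"
    by (intro bop_eqI ell2_eqI) (simp add: coord_adj_shift_op coord_vacuum_proj)
  have 2: "adj shift_op * diag_op \<beta> = adj shift_op"
    by (intro bop_eqI ell2_eqI) (simp add: \<beta> coord_adj_shift_op coord_diag_op[OF bounded_range_If])
  have 3: "diag_op \<beta> * shift_op = shift_op"
    by (intro bop_eqI ell2_eqI)
      (simp add: \<beta> coord_shift_op coord_diag_op[OF bounded_range_If] split: nat.split)
  have u: "coupling_op \<alpha> \<beta> = vector [vector [0, \<i> *\<^sub>C adj shift_op],
      vector [\<i> *\<^sub>C shift_op, vacuum_proj]]"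
    by (simp add: coupling_op_def Let_def a 1 2 3)
  have "\<psi> y = trace (density_matrix lam zeta ** y)" for y
    using assms(5) by (simp add: state_parameters_def)
  then have \<psi>: "\<psi> (cmat_unit 1 1) = of_real lam"
      "\<psi> (cmat_unit 1 2) = zeta * of_real (sqrt (lam * (1 - lam)))"
      "\<psi> (cmat_unit 2 1) = cnj zeta * of_real (sqrt (lam * (1 - lam)))"
      "\<psi> (cmat_unit 2 2) = of_real (1 - lam)"
    by (simp_all add: trace_density_matrix cmat_unit_def)
  have mult_scale: "(c *\<^sub>C y) * z = c *\<^sub>C (y * z)" "y * (c *\<^sub>C z) = c *\<^sub>C (y * z)" for c and y z :: bop
    by (rule bop_eqI, simp add: op_apply_scaleC)+
  have sc0: "0 *\<^sub>C y = 0" "(- c) *\<^sub>C y = - (c *\<^sub>C y)" for c and y :: bop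
    by simp_all
  show "transition_op \<alpha> \<beta> \<psi> x = walk_op lam (\<i> * zeta * of_real (sqrt (lam * (1 - lam)))) x"
    by (simp add: transition_op_def u cond_exp_def mat_adj_def op_tensor_def mat_def
        matrix_matrix_mult_def sum_2 \<psi> adj_scaleC adj_adj
        adj_zero adj_vacuum_proj walk_op_def mult_scale scaleC_scaleC scaleC_one mult.assoc mult_ac)
qed

lemma entry_walk_op_interior:
  "entry (walk_op lam \<kappa> x) (Suc m) (Suc n) =
     of_real lam * entry x (Suc (Suc m)) (Suc (Suc n)) + of_real (1 - lam) * entry x m n"
  by (simp add: walk_op_def) (simp add: entry_def coord_adj_shift_op coord_shift_op coord_vacuum_proj
      shift_op_basis_vec adj_shift_op_basis_vec vacuum_proj_basis_vec op_apply_zero)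

lemma entry_walk_op_column:
  "entry (walk_op lam \<kappa> x) (Suc m) 0 =
     of_real lam * entry x (Suc (Suc m)) 1 - \<kappa> * entry x (Suc (Suc m)) 0"
  by (simp add: walk_op_def) (simp add: entry_def coord_adj_shift_op coord_shift_op coord_vacuum_proj
      shift_op_basis_vec adj_shift_op_basis_vec vacuum_proj_basis_vec op_apply_zero)

lemma entry_walk_op_row:
  "entry (walk_op lam \<kappa> x) 0 (Suc n) =
     of_real lam * entry x 1 (Suc (Suc n)) - cnj \<kappa> * entry x 0 (Suc (Suc n))"
  by (simp add: walk_op_def) (simp add: entry_def coord_adj_shift_op coord_shift_op coord_vacuum_proj
      shift_op_basis_vec adj_shift_op_basis_vec vacuum_proj_basis_vec op_apply_zero)

lemma entry_walk_op_corner: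
  "entry (walk_op lam \<kappa> x) 0 0 =
     of_real lam * entry x 1 1 + of_real (1 - lam) * entry x 0 0 - \<kappa> * entry x 1 0 - cnj \<kappa> * entry x 0 1"
  by (simp add: walk_op_def) (simp add: entry_def coord_adj_shift_op coord_shift_op coord_vacuum_proj
      shift_op_basis_vec adj_shift_op_basis_vec vacuum_proj_basis_vec op_apply_zero)

lemmas entry_walk_op = entry_walk_op_interior entry_walk_op_column entry_walk_op_row
  entry_walk_op_corner

text \<open>The reflecting boundary term \<open>p x p\<close> makes the walk conservative on the main diagonal.\<close>

lemma walk_op_scalar: "walk_op lam \<kappa> (c *\<^sub>C 1) = c *\<^sub>C 1"
proof (rule bop_eq_entryI)
  fix m n
  show "entry (walk_op lam \<kappa> (c *\<^sub>C 1)) m n = entry (c *\<^sub>C 1) m n"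
    by (cases m; cases n) (simp_all add: entry_walk_op entry_one algebra_simps)
qed


section \<open>Outward drift: infinitely many fixed points\<close>

text \<open>Write \<open>S\<close> for the shift, \<open>p\<close> for \<open>vacuum_proj\<close> and \<open>D = diag (r\<^sup>n)\<close>. For \<open>j \<ge> 1\<close> the operators \<open>S\<^sup>j\<close> and \<open>S\<^sup>j D\<close> fail to be fixed only
  at the boundary: \<open>T x - x\<close> is \<open>- (1 - \<lambda>) S\<^sup>j p - \<kappa> S\<^sup>j\<^sup>-\<^sup>1 p\<close> for the first and
  \<open>- \<lambda> S\<^sup>j p - \<kappa> S\<^sup>j\<^sup>-\<^sup>1 p\<close> for the second. The combination \<open>\<lambda> S\<^sup>j - (1 - \<lambda>) S\<^sup>j D\<close>
  cancels the first kind of defect and leaves \<open>- \<kappa> (2 \<lambda> - 1) S\<^sup>j\<^sup>-\<^sup>1 p\<close>, which is exactly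
  compensated by \<open>\<kappa> (S\<^sup>j\<^sup>-\<^sup>1 - S\<^sup>j\<^sup>-\<^sup>1 D)\<close>. For \<open>\<lambda> = 1\<close> the convention
  \<open>0\<^sup>0 = 1\<close> makes \<open>D\<close> the projection \<open>p\<close>, and the formula remains valid.\<close>

definition fixed_op :: "real \<Rightarrow> complex \<Rightarrow> nat \<Rightarrow> bop" where
  "fixed_op lam \<kappa> k = (let r = (1 - lam) / lam in
     shift_op ^ Suc k * diag_op (\<lambda>n. of_real (lam - (1 - lam) * r ^ n))
     + \<kappa> *\<^sub>C (shift_op ^ k * diag_op (\<lambda>n. of_real (1 - r ^ n))))"

lemma shift_op_power_basis_vec: "op_apply (shift_op ^ k) (basis_vec n) = basis_vec (n + k)"
  by (induction k) (simp_all add: shift_op_basis_vec)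

lemma bounded_range_geometric:
  assumes "0 \<le> r" "r \<le> (1::real)"
  shows "bounded (range (\<lambda>n. complex_of_real (A + B * r ^ n)))"
  unfolding bounded_iff
proof (intro exI[of _ "\<bar>A\<bar> + \<bar>B\<bar>"] ballI)
  fix z assume "z \<in> range (\<lambda>n. complex_of_real (A + B * r ^ n))"
  then obtain n where z: "z = complex_of_real (A + B * r ^ n)" by blast
  have "\<bar>A + B * r ^ n\<bar> \<le> \<bar>A\<bar> + \<bar>B\<bar> * r ^ n"
    using abs_triangle_ineq[of A "B * r ^ n"] assms by (simp add: abs_mult)
  also have "\<dots> \<le> \<bar>A\<bar> + \<bar>B\<bar>"
    using assms by (simp add: mult_left_le power_le_one)
  finally show "norm z \<le> \<bar>A\<bar> + \<bar>B\<bar>" by (simp only: z norm_of_real)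
qed

lemma entry_fixed_op:
  assumes "1/2 < lam" "lam \<le> 1"
  shows "entry (fixed_op lam \<kappa> k) m n =
     (if m = n + Suc k then of_real (lam - (1 - lam) * ((1 - lam) / lam) ^ n) else 0)
     + \<kappa> * (if m = n + k then of_real (1 - ((1 - lam) / lam) ^ n) else 0)"
proof -
  have r: "0 \<le> (1 - lam) / lam" "(1 - lam) / lam \<le> 1"
    using assms by (auto simp: divide_simps)
  show ?thesis
    using bounded_range_geometric[OF r, of lam "- (1 - lam)"] bounded_range_geometric[OF r, of 1 "- 1"]
    by (simp only: minus_mult_left[symmetric] mult_1 add_uminus_conv_diff fixed_op_def Let_def entry_linear)
      (simp add: entry_def diag_op_basis_vec op_apply_scaleC shift_op_power_basis_vec coord_basis_vec
        shift_op_basis_vec del: power_Suc)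
qed

lemma fixed_op_fixed:
  assumes "1/2 < lam" "lam \<le> 1"
  shows "walk_op lam \<kappa> (fixed_op lam \<kappa> k) = fixed_op lam \<kappa> k"
proof (rule bop_eq_entryI)
  fix m n
  define r where "r = complex_of_real ((1 - lam) / lam)"
  have r: "r * of_real lam = 1 - of_real lam"
    using assms by (simp add: r_def)
  have r': "r * (of_real lam * z) = z - of_real lam * z" for z
    using r by (metis left_diff_distrib mult.assoc mult_1)
  note E = entry_fixed_op[OF assms, unfolded of_real_diff of_real_mult of_real_power, folded r_def]
  show "entry (walk_op lam \<kappa> (fixed_op lam \<kappa> k)) m n = entry (fixed_op lam \<kappa> k) m n"
    by (cases m; cases n) (auto simp add: entry_walk_op E r r' algebra_simps)
qed

lemma infinite_dimensional_fixed_points_walk_op: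
  assumes "1/2 < lam" "lam \<le> 1"
  shows "infinite_dimensional (fixed_points (walk_op lam \<kappa>))"
proof -
  define X where "X = fixed_op lam \<kappa>"
  \<comment> \<open>Column \<open>0\<close> of \<open>1 - D\<close> is zero, so \<open>X k\<close> sends \<open>e\<^sub>0\<close> to a nonzero multiple of \<open>e\<^sub>k\<^sub>+\<^sub>1\<close>;
    this alone gives linear independence.\<close>
  have X0: "entry (X k) (Suc j) 0 = (if k = j then of_real (2 * lam - 1) else 0)" for k j
    by (simp add: X_def entry_fixed_op[OF assms])
  have nz: "complex_of_real (2 * lam - 1) \<noteq> 0"
    using assms(1) by (simp only: of_real_eq_0_iff)
  have inj: "inj X"
    using X0 nz by (metis injI)
  have entry_sum: "entry (sum f A) m n = (\<Sum>a\<in>A. entry (f a) m n)" for f :: "bop \<Rightarrow> bop" and A m n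
    by (induction A rule: infinite_finite_induct) (simp_all add: entry_def)
  have "\<not> complex_vector.dependent (range X)"
    unfolding complex_vector.dependent_explicit
  proof (intro notI, elim exE conjE bexE)
    fix t u v
    assume t: "finite t" "t \<subseteq> range X" and s: "(\<Sum>v\<in>t. u v *\<^sub>C v) = 0"
      and v: "v \<in> t" "u v \<noteq> 0"
    obtain k where k: "X k \<in> t" "u (X k) \<noteq> 0"
      using t(2) v by auto
    have "0 = entry (\<Sum>v\<in>t. u v *\<^sub>C v) (Suc k) 0"
      by (simp add: s entry_def)
    also have "\<dots> = (\<Sum>v\<in>t. if v = X k then u (X k) * of_real (2 * lam - 1) else 0)"
      unfolding entry_sum
      by (rule sum.cong) (use t(2) inj in \<open>auto simp: X0 inj_eq simp del: of_real_diff of_real_mult\<close>)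
    also have "\<dots> = u (X k) * of_real (2 * lam - 1)"
      using t(1) k(1) by (simp add: sum.delta del: of_real_diff of_real_mult)
    finally show False using k(2) nz by simp
  qed
  moreover have "range X \<subseteq> fixed_points (walk_op lam \<kappa>)"
    using fixed_op_fixed[OF assms] by (auto simp: X_def fixed_points_def)
  moreover have "infinite (range X)"
    using inj finite_imageD by blast
  ultimately show ?thesis
    unfolding infinite_dimensional_def
    using complex_vector.independent_span_bound by blast
qed


section \<open>No outward drift: peripheral eigenvectors are scalar\<close>

text \<open>For a walk without outward drift, subharmonicity lets every positive increment be followed by
  one that is at least as large, so a single positive increment would force linear growth.\<close>

lemma bounded_subharmonic_le_initial:
  fixes z :: "nat \<Rightarrow> real"
  assumes lam: "0 \<le> lam" "lam \<le> 1/2" and bnd: "\<And>j. z j \<le> K"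
    and sub: "\<And>j. z (Suc j) \<le> lam * z (Suc (Suc j)) + (1 - lam) * z j"
  shows "z j \<le> z 0"
proof -
  have step: "z (Suc j) \<le> z j" for j
  proof (rule ccontr)
    assume "\<not> z (Suc j) \<le> z j"
    define d where "d = z (Suc j) - z j"
    with \<open>\<not> z (Suc j) \<le> z j\<close> have d: "d > 0" by simp
    have inc: "z (Suc (j + i)) - z (j + i) \<ge> d" for i
    proof (induction i)
      case (Suc i)
      define D D' where "D = z (Suc (j + i)) - z (j + i)"
        and "D' = z (Suc (Suc (j + i))) - z (Suc (j + i))"
      have "(1 - lam) * D \<le> lam * D'"
        using sub[of "j + i"] by (simp add: D_def D'_def algebra_simps)
      moreover have "lam * D \<le> (1 - lam) * D" "(1 - lam) * D > 0"
        using lam Suc.IH d by (auto simp: D_def intro!: mult_right_mono)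
      ultimately have "lam * D \<le> lam * D'" "lam > 0"
        using lam by (linarith, metis less_le mult_zero_left not_less)
      then have "D \<le> D'" by simp
      with Suc.IH show ?case by (simp add: D_def D'_def)
    qed (simp add: d_def)
    have grow: "z (j + i) \<ge> z j + of_nat i * d" for i
    proof (induction i)
      case (Suc i)
      with inc[of i] show ?case by (simp add: algebra_simps)
    qed simp
    obtain i where "K - z j < of_nat i * d"
      using reals_Archimedean3[OF d] by blast
    with grow[of i] bnd[of "j + i"] show False by simp
  qed
  show ?thesis by (induction j) (use step order_trans in auto)
qed

text \<open>Here \<open>z k j\<close> stands for the modulus of the \<open>j\<close>-th entry on the \<open>k\<close>-th diagonal above or below
  the main one. The walk contributes at most \<open>lam * z k 0\<close> to the boundary inequality, which thus
  becomes \<open>(1 - lam) * z k 0 \<le> \<kappa> * z (Suc k) 0\<close>: the boundary values do not decrease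
  in \<open>k\<close>, but tend to \<open>0\<close>.\<close>

lemma subharmonic_triangle_vanishes:
  fixes z :: "nat \<Rightarrow> nat \<Rightarrow> real"
  assumes lam: "0 \<le> lam" "lam \<le> 1/2" and kap: "0 \<le> \<kappa>" "\<kappa> \<le> 1 - lam"
    and nonneg: "\<And>k j. 0 \<le> z k j" and bnd: "\<And>k j. z k j \<le> K"
    and sub: "\<And>k j. z k (Suc j) \<le> lam * z k (Suc (Suc j)) + (1 - lam) * z k j"
    and boundary: "\<And>k. z k 0 \<le> lam * z k 1 + \<kappa> * z (Suc k) 0"
    and lim: "(\<lambda>k. z k 0) \<longlonglongrightarrow> 0"
  shows "z k j = 0"
proof -
  have anti: "z k j \<le> z k 0" for k j
    using lam bnd sub by (rule bounded_subharmonic_le_initial)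
  have "z k 0 \<le> z (Suc k) 0" for k
  proof -
    have "lam * z k 1 \<le> lam * z k 0" "\<kappa> * z (Suc k) 0 \<le> (1 - lam) * z (Suc k) 0"
      using anti[of k 1] lam kap nonneg by (auto intro: mult_left_mono mult_right_mono)
    then have "(1 - lam) * z k 0 \<le> (1 - lam) * z (Suc k) 0"
      using boundary[of k] by (simp add: algebra_simps)
    then show ?thesis using lam by simp
  qed
  then have "incseq (\<lambda>k. z k 0)" by (simp add: incseq_Suc_iff)
  then have "z k 0 \<le> 0" using lim by (rule incseq_le)
  then show ?thesis using anti[of k j] nonneg[of k j] by linarith
qed

text \<open>For \<open>lam \<le> 1/2\<close> the geometric mean of \<open>lam\<close> and \<open>1 - lam\<close> is at most the larger of the
  two, which is \<open>1 - lam\<close>.\<close>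

lemma norm_coupling_le:
  assumes "0 \<le> lam" "lam \<le> 1/2" "cmod zeta \<le> 1"
  shows "cmod (\<i> * zeta * of_real (sqrt (lam * (1 - lam)))) \<le> 1 - lam"
proof -
  have "sqrt (lam * (1 - lam)) \<le> sqrt ((1 - lam)\<^sup>2)"
    using assms unfolding power2_eq_square by (intro real_sqrt_le_mono mult_right_mono) auto
  also have "\<dots> = 1 - lam"
    using assms by simp
  finally have "cmod zeta * sqrt (lam * (1 - lam)) \<le> 1 * (1 - lam)"
    using assms by (intro mult_mono) auto
  then show ?thesis
    using assms by (simp add: norm_mult)
qed

lemma norm_le_of_eigen:
  assumes "cmod \<mu> = 1" "\<mu> * w = of_real p * u + v" "0 \<le> p"
  shows "cmod w \<le> p * cmod u + cmod v"
proof -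
  have "cmod w = cmod (\<mu> * w)" using assms(1) by (simp add: norm_mult)
  also have "\<dots> \<le> p * cmod u + cmod v"
    unfolding assms(2) using norm_triangle_ineq[of "of_real p * u" v] assms(3) by (simp add: norm_mult)
  finally show ?thesis .
qed

text \<open>Once the other diagonals vanish, the main diagonal \<open>w\<close> solves the recurrence of a reflected
  walk. For \<open>\<mu> = 1\<close> the boundary equation and the recurrence force all increments
  to be \<open>0\<close>. For \<open>\<mu> \<noteq> 1\<close> the
  boundary equation would require \<open>cmod (\<mu> - (1 - lam)) \<le> lam\<close> unless \<open>w 0 = 0\<close>; but the disc of
  radius \<open>lam\<close> around \<open>1 - lam\<close> touches the unit circle only at \<open>1\<close>.\<close>

lemma walk_op_peripheral_eigenvector_scalar:
  assumes lam: "0 \<le> lam" "lam \<le> 1/2" and kap: "cmod \<kappa> \<le> 1 - lam"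
    and \<mu>: "cmod \<mu> = 1" and eig: "walk_op lam \<kappa> x = \<mu> *\<^sub>C x"
  shows "x \<in> scalar_ops"
proof -
  have ev: "\<mu> * entry x m n = entry (walk_op lam \<kappa> x) m n" for m n
    by (simp add: eig)
  obtain K where K: "\<And>m n. cmod (entry x m n) \<le> K"
    using entry_bounded by blast
  have sub: "cmod (entry x (Suc m) (Suc n))
      \<le> lam * cmod (entry x (Suc (Suc m)) (Suc (Suc n))) + (1 - lam) * cmod (entry x m n)" for m n
  proof -
    have "cmod (of_real (1 - lam) * entry x m n) = (1 - lam) * cmod (entry x m n)"
      using lam unfolding norm_mult norm_of_real by simp
    then show ?thesis
      using norm_le_of_eigen[OF \<mu> ev[of "Suc m" "Suc n", unfolded entry_walk_op] lam(1)] by simp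
  qed
  have lower: "cmod (entry x (j + Suc k) j) = 0" for j k
  proof (rule subharmonic_triangle_vanishes[where z = "\<lambda>k j. cmod (entry x (j + Suc k) j)",
        OF lam _ kap])
    show "cmod (entry x (0 + Suc k) 0)
        \<le> lam * cmod (entry x (1 + Suc k) 1) + cmod \<kappa> * cmod (entry x (0 + Suc (Suc k)) 0)" for k
      using norm_le_of_eigen[OF \<mu> ev[of "Suc k" 0, unfolded entry_walk_op diff_conv_add_uminus] lam(1)]
      by (simp add: norm_mult)
    show "(\<lambda>k. cmod (entry x (0 + Suc k) 0)) \<longlonglongrightarrow> 0"
      using LIMSEQ_Suc[OF tendsto_norm_zero[OF entry_column_tendsto_zero]] by simp
  qed (use K sub in auto)
  have upper: "cmod (entry x j (j + Suc k)) = 0" for j k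
  proof (rule subharmonic_triangle_vanishes[where z = "\<lambda>k j. cmod (entry x j (j + Suc k))",
        OF lam _ kap])
    show "cmod (entry x 0 (0 + Suc k))
        \<le> lam * cmod (entry x 1 (1 + Suc k)) + cmod \<kappa> * cmod (entry x 0 (0 + Suc (Suc k)))" for k
      using norm_le_of_eigen[OF \<mu> ev[of 0 "Suc k", unfolded entry_walk_op diff_conv_add_uminus] lam(1)]
      by (simp add: norm_mult)
    show "(\<lambda>k. cmod (entry x 0 (0 + Suc k))) \<longlonglongrightarrow> 0"
      using LIMSEQ_Suc[OF tendsto_norm_zero[OF entry_row_tendsto_zero]] by simp
  qed (use K sub in auto)
  have off: "entry x m n = 0" if "m \<noteq> n" for m n
    using lower[of n "m - Suc n"] upper[of m "n - Suc m"] that by (cases "m < n") auto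
  define w where "w j = entry x j j" for j
  have w_rec: "\<mu> * w (Suc j) = of_real lam * w (Suc (Suc j)) + of_real (1 - lam) * w j" for j
    using ev[of "Suc j" "Suc j"] by (simp add: entry_walk_op w_def)
  have w0: "\<mu> * w 0 = of_real lam * w 1 + of_real (1 - lam) * w 0"
    using ev[of 0 0] by (simp add: entry_walk_op w_def off)
  have w_anti: "cmod (w j) \<le> cmod (w 0)" for j
    by (rule bounded_subharmonic_le_initial[where z = "\<lambda>j. cmod (w j)" and K = K, OF lam])
      (simp_all only: w_def K sub)
  have const: "w j = w 0" for j
  proof (cases "\<mu> = 1")
    case True
    have d0: "of_real lam * (w 1 - w 0) = 0"
      using w0 True by (auto simp: algebra_simps)
    have d: "of_real lam * (w (Suc (Suc i)) - w (Suc i)) = of_real (1 - lam) * (w (Suc i) - w i)" for i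
      using w_rec[of i] True by (simp add: algebra_simps)
    have "w (Suc i) = w i" for i
    proof (cases "lam = 0")
      case True
      then show ?thesis using d[of i] by simp
    next
      case False
      show ?thesis
      proof (induction i)
        case 0
        show ?case using d0 False by simp
      next
        case (Suc i)
        then show ?case using d[of i] False by simp
      qed
    qed
    then show ?thesis by (induction j) auto
  next
    case False
    have "w 0 = 0"
    proof (rule ccontr)
      assume nz: "w 0 \<noteq> 0"
      have "(\<mu> - of_real (1 - lam)) * w 0 = of_real lam * w 1"
        using w0 by (simp add: algebra_simps)
      then have "cmod (\<mu> - of_real (1 - lam)) * cmod (w 0) = lam * cmod (w 1)"
        using lam(1) by (metis norm_mult norm_of_real abs_of_nonneg)
      also have "\<dots> \<le> lam * cmod (w 0)"
        using lam w_anti by (intro mult_left_mono) auto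
      finally have "cmod (\<mu> - of_real (1 - lam)) \<le> lam"
        using nz by simp
      then have "(cmod (\<mu> - of_real (1 - lam)))\<^sup>2 \<le> lam\<^sup>2"
        by (intro power_mono) auto
      then have "(Re \<mu> - (1 - lam))\<^sup>2 + (Im \<mu>)\<^sup>2 \<le> lam\<^sup>2"
        by (simp add: cmod_power2)
      moreover have unit: "(Re \<mu>)\<^sup>2 + (Im \<mu>)\<^sup>2 = 1"
        using \<mu> cmod_power2[of \<mu>] by simp
      ultimately have "(1 - lam) * 1 \<le> (1 - lam) * Re \<mu>"
        by (simp add: algebra_simps power2_eq_square)
      then have "Re \<mu> \<ge> 1" using lam by simp
      moreover have "Re \<mu> \<le> 1" using complex_Re_le_cmod[of \<mu>] \<mu> by simp
      ultimately have "Re \<mu> = 1" by simp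
      with unit False show False by (simp add: complex_eq_iff)
    qed
    then show ?thesis using w_anti[of j] by simp
  qed
  have "x = w 0 *\<^sub>C 1"
    by (rule bop_eq_entryI) (use const off in \<open>auto simp: entry_one w_def\<close>)
  then show ?thesis unfolding scalar_ops_def by blast
qed


section \<open>The dichotomy\<close>

lemma scalar_ops_finite_dimensional: "\<not> infinite_dimensional scalar_ops"
proof -
  have "scalar_ops \<subseteq> complex_vector.span {1}"
    unfolding scalar_ops_def by (auto intro: complex_vector.span_scale complex_vector.span_base)
  then show ?thesis unfolding infinite_dimensional_def by blast
qed

theorem theorem5p4:
  fixes \<alpha> \<beta> :: "nat \<Rightarrow> complex"
    and \<psi> :: "complex^2^2 \<Rightarrow> complex"
    and lam :: real and zeta :: complex
  assumes "\<alpha> 0 = 1" and "\<beta> 0 = 0"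
    and "\<And>n. n \<ge> 1 \<Longrightarrow> \<alpha> n = 0" and "\<And>n. n \<ge> 1 \<Longrightarrow> \<beta> n = 1"
    and "is_state \<psi>" and "state_parameters \<psi> lam zeta"
  shows "(weakly_mixing (transition_op \<alpha> \<beta> \<psi>) \<longleftrightarrow> lam \<le> 1/2)
    \<and> (weakly_mixing (transition_op \<alpha> \<beta> \<psi>) \<longrightarrow> ergodic (transition_op \<alpha> \<beta> \<psi>))
    \<and> (lam > 1/2 \<longrightarrow> infinite_dimensional (fixed_points (transition_op \<alpha> \<beta> \<psi>)))"
proof -
  define \<kappa> where "\<kappa> = \<i> * zeta * of_real (sqrt (lam * (1 - lam)))"
  define T where "T = transition_op \<alpha> \<beta> \<psi>"
  have T: "T = walk_op lam \<kappa>"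
    unfolding T_def \<kappa>_def by (rule transition_op_eq_walk_op) (use assms in auto)
  have par: "0 \<le> lam" "lam \<le> 1" "cmod zeta \<le> 1"
    using assms(6) by (auto simp: state_parameters_def)
  have erg: "ergodic T" if "weakly_mixing T"
  proof -
    have "fixed_points T \<subseteq> scalar_ops"
      using that by (auto simp: weakly_mixing_def fixed_points_def scaleC_one dest: spec[of _ 1])
    moreover have "scalar_ops \<subseteq> fixed_points T"
      by (auto simp: scalar_ops_def fixed_points_def T walk_op_scalar)
    ultimately show ?thesis by (auto simp: ergodic_def)
  qed
  have inf: "infinite_dimensional (fixed_points T)" if "lam > 1/2"
    unfolding T using that par(2) by (rule infinite_dimensional_fixed_points_walk_op)
  have "weakly_mixing T" if "lam \<le> 1/2"
    unfolding weakly_mixing_def T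
    using walk_op_peripheral_eigenvector_scalar[OF par(1) that] norm_coupling_le[OF par(1) that par(3)]
    by (auto simp: \<kappa>_def)
  moreover have "\<not> weakly_mixing T" if "lam > 1/2"
    using erg inf[OF that] scalar_ops_finite_dimensional by (auto simp: ergodic_def)
  ultimately show ?thesis
    using erg inf unfolding T_def[symmetric] by (meson not_le)
qed

end
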